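(* Let $x$ be a reordered computable number which is nearly computable. Then $x$ is computable.
   Context: $\mathbb{N}=\{0,1,2,\dots\}$. A convergent sequence $(x_n)_n$ with limit $x$ converges computably (to $x$) if there is a computable $s\colon\mathbb{N}\to\mathbb{N}$ with $|x-x_k|\le 2^{-n}$ for all $n$ and all $k\ge s(n)$; a series converges computably if the sequence of its partial sums $\left(\sum_{k=0}^{n-1}a_k\right)_n$ does (no computability of the terms is required). A real number is computable if some computable sequence of rational numbers converges computably to it. A sequence $(x_n)_n$ of reals is nearly computably convergent if it converges and, for every computable strictly increasing function $s\colon\mathbb{N}\to\mathbb{N}$, the sequence $(x_{s(n+1)}-x_{s(n)})_n$ converges computably to $0$. A real number is nearly computable if there exists a computable sequence of rational numbers which converges nearly computably to it. A function $f\colon\mathbb{N}\to\mathbb{N}$ tends to infinity if for every $c$ there is $m$ with $f(n)>c$ for all $n\ge m$. For such $f$, $u_f(n) := |\{k\in\mathbb{N} \mid f(k)=n\}|$. A function $f\colon\mathbb{N}\to\mathbb{N}$ is a name for a real number $x$ if $\sum_{k=0}^\infty 2^{-f(k)} = x$ (then $f$ tends to infinity). A real number is reordered computable if it has a computable name $f$ such that $\sum_{k=0}^\infty u_f(k)\cdot 2^{-k}$ converges computably. *)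

theory Defs
  imports Complex_Main
begin

text \<open>Partial recursive functions: programs and their input-output relation.
  Programs carry no arity; the input list determines it.\<close>

datatype recf =
    Zero
  | Succ
  | Proj nat
  | Comp recf "recf list"
  | Prim recf recf
  | Mu recf

inductive computes :: "recf \<Rightarrow> nat list \<Rightarrow> nat \<Rightarrow> bool" where
  computes_Zero: "computes Zero xs 0"
| computes_Succ: "computes Succ [x] (Suc x)"
| computes_Proj: "i < length xs \<Longrightarrow> computes (Proj i) xs (xs ! i)"
| computes_Comp: "list_all2 (\<lambda>g y. computes g xs y) gs ys \<Longrightarrow> computes f ys z
    \<Longrightarrow> computes (Comp f gs) xs z"
| computes_Prim_0: "computes f xs z \<Longrightarrow> computes (Prim f g) (0 # xs) z"
| computes_Prim_Suc: "computes (Prim f g) (n # xs) y \<Longrightarrow> computes g (n # y # xs) z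
    \<Longrightarrow> computes (Prim f g) (Suc n # xs) z"
| computes_Mu: "computes f (n # xs) 0 \<Longrightarrow> (\<forall>i<n. \<exists>y. computes f (i # xs) (Suc y))
    \<Longrightarrow> computes (Mu f) xs n"

inductive_cases computes_ZeroE: "computes Zero xs z"
inductive_cases computes_SuccE: "computes Succ xs z"
inductive_cases computes_ProjE: "computes (Proj i) xs z"
inductive_cases computes_CompE: "computes (Comp f gs) xs z"
inductive_cases computes_Prim_0E: "computes (Prim f g) (0 # xs) z"
inductive_cases computes_Prim_SucE: "computes (Prim f g) (Suc n # xs) z"
inductive_cases computes_MuE: "computes (Mu f) xs z"

lemma computes_deterministic:
  assumes "computes c xs y" and "computes c xs z"
  shows "y = z"
  using assms
proof (induction c xs y arbitrary: z rule: computes.induct)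
  case (computes_Zero xs)
  then show ?case by (rule computes_ZeroE) simp
next
  case (computes_Succ x)
  then show ?case by (rule computes_SuccE) simp
next
  case (computes_Proj i xs)
  from computes_Proj.prems show ?case by (rule computes_ProjE) simp
next
  case (computes_Comp xs gs ys f z')
  from computes_Comp.prems obtain ys' where
    ys': "list_all2 (\<lambda>g y. computes g xs y) gs ys'" and f: "computes f ys' z"
    by (rule computes_CompE)
  have "ys = ys'"
    using computes_Comp.IH(1) ys'
    by (simp add: list_all2_conv_all_nth list_eq_iff_nth_eq)
  with computes_Comp.IH(2) f show ?case by blast
next
  case (computes_Prim_0 f xs z' g)
  from computes_Prim_0.prems have "computes f xs z" by (rule computes_Prim_0E)
  with computes_Prim_0.IH show ?case by blast
next
  case (computes_Prim_Suc f g n xs y z')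
  from computes_Prim_Suc.prems obtain y' where
    "computes (Prim f g) (n # xs) y'" and "computes g (n # y' # xs) z"
    by (rule computes_Prim_SucE)
  with computes_Prim_Suc.IH show ?case by blast
next
  case (computes_Mu f n xs)
  from computes_Mu.prems have z: "computes f (z # xs) 0"
    and below: "\<forall>i<z. \<exists>y. computes f (i # xs) (Suc y)"
    by (rule computes_MuE, blast)+
  show ?case
  proof (rule linorder_cases[of n z])
    assume "n < z"
    with below computes_Mu.IH(1) show ?thesis by (metis nat.distinct(1))
  next
    assume "z < n"
    with computes_Mu.IH(2) z show ?thesis by (metis nat.distinct(1))
  qed
qed

definition computable :: "(nat \<Rightarrow> nat) \<Rightarrow> bool" where
  "computable f \<longleftrightarrow> (\<exists>c. \<forall>n. computes c [n] (f n))"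

definition computable_rat_seq :: "(nat \<Rightarrow> rat) \<Rightarrow> bool" where
  "computable_rat_seq q \<longleftrightarrow> (\<exists>a b c. computable a \<and> computable b \<and> computable c \<and>
     (\<forall>n. q n = (of_nat (a n) - of_nat (b n)) / of_nat (Suc (c n))))"

definition converges_computably :: "(nat \<Rightarrow> real) \<Rightarrow> real \<Rightarrow> bool" where
  "converges_computably X x \<longleftrightarrow> X \<longlonglongrightarrow> x \<and>
     (\<exists>s. computable s \<and> (\<forall>n. \<forall>k\<ge>s n. \<bar>x - X k\<bar> \<le> (1 / 2) ^ n))"

definition series_converges_computably :: "(nat \<Rightarrow> real) \<Rightarrow> bool" where
  "series_converges_computably a \<longleftrightarrow> (\<exists>x. converges_computably (\<lambda>n. \<Sum>k<n. a k) x)"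

definition computable_real :: "real \<Rightarrow> bool" where
  "computable_real x \<longleftrightarrow>
     (\<exists>q. computable_rat_seq q \<and> converges_computably (\<lambda>n. of_rat (q n)) x)"

definition nearly_computably_convergent :: "(nat \<Rightarrow> real) \<Rightarrow> bool" where
  "nearly_computably_convergent X \<longleftrightarrow> convergent X \<and>
     (\<forall>s. computable s \<longrightarrow> strict_mono s \<longrightarrow>
        converges_computably (\<lambda>n. X (s (n + 1)) - X (s n)) 0)"

definition nearly_computable :: "real \<Rightarrow> bool" where
  "nearly_computable x \<longleftrightarrow> (\<exists>q. computable_rat_seq q \<and>
     (\<lambda>n. of_rat (q n)) \<longlonglongrightarrow> x \<and> nearly_computably_convergent (\<lambda>n. of_rat (q n)))"

definition is_name :: "(nat \<Rightarrow> nat) \<Rightarrow> real \<Rightarrow> bool" where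
  "is_name f x \<longleftrightarrow> (\<lambda>k. (1 / 2 :: real) ^ f k) sums x"

definition u :: "(nat \<Rightarrow> nat) \<Rightarrow> nat \<Rightarrow> nat" where
  "u f n = card {k. f k = n}"

lemma is_name_tends_to_infinity:
  assumes "is_name f x"
  shows "filterlim f at_top sequentially"
proof -
  have lim: "(\<lambda>k. (1 / 2 :: real) ^ f k) \<longlonglongrightarrow> 0"
    using assms unfolding is_name_def by (intro summable_LIMSEQ_zero) (rule sums_summable)
  show ?thesis
    unfolding filterlim_at_top
  proof
    fix c :: nat
    have "\<forall>\<^sub>F k in sequentially. (1 / 2 :: real) ^ f k < (1 / 2) ^ c"
      using lim by (rule order_tendstoD) simp
    then show "\<forall>\<^sub>F k in sequentially. c \<le> f k"
    proof eventually_elim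
      case (elim k)
      show ?case
      proof (rule ccontr)
        assume "\<not> c \<le> f k"
        then have "(1 / 2 :: real) ^ c \<le> (1 / 2) ^ f k"
          by (intro power_decreasing) auto
        with elim show False by simp
      qed
    qed
  qed
qed

text \<open>Hence \<open>u f\<close> counts finite sets whenever \<open>f\<close> is a name, and the convention that
  \<open>card\<close> of an infinite set is \<open>0\<close> plays no role there.\<close>

lemma is_name_finite_fiber:
  assumes "is_name f x"
  shows "finite {k. f k = n}"
proof -
  from is_name_tends_to_infinity[OF assms] have "\<forall>\<^sub>F k in sequentially. Suc n \<le> f k"
    unfolding filterlim_at_top by blast
  then obtain m where m: "\<And>k. k \<ge> m \<Longrightarrow> Suc n \<le> f k"
    unfolding eventually_sequentially by blast
  have "{k. f k = n} \<subseteq> {..<m}"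
    using m by (force simp: not_le[symmetric])
  then show ?thesis by (rule finite_subset) simp
qed

definition reordered_computable :: "real \<Rightarrow> bool" where
  "reordered_computable x \<longleftrightarrow> (\<exists>f. computable f \<and> is_name f x \<and>
     series_converges_computably (\<lambda>k. of_nat (u f k) * (1 / 2) ^ k))"

end

theory Submission
  imports Defs
begin

text \<open>
  Let \<open>f\<close> be a computable name of \<open>x\<close> with a computably convergent series
  \<open>\<Sum>k. u f k / 2 ^ k\<close>, and let \<open>p n\<close> be the sum of the first \<open>n\<close> terms \<open>1 / 2 ^ f k\<close>.
  If \<open>f\<close> tends to infinity with a computable modulus, then \<open>x\<close> is computable: once every
  further value of \<open>f\<close> is at least \<open>G\<close>, the error \<open>x - p k\<close> is a sum of terms
  \<open>1 / 2 ^ f i\<close> with \<open>f i \<ge> G\<close>, hence it is at most the tail of the reordered series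
  from \<open>G\<close> on (\<open>name_segment_le_reordered_tail\<close>), and that tail is controlled computably.

  So it remains to see that \<open>1 / 2 ^ f k = p (k + 1) - p k\<close> converges computably to \<open>0\<close>, and
  this is where near computability of \<open>x\<close> enters. It supplies a computable rational
  sequence \<open>q\<close> that converges to \<open>x\<close> nearly computably, and that sequence has to be
  compared with \<open>p\<close>. As both have the limit \<open>x\<close>, an unbounded search finds
  a computable strictly increasing \<open>r\<close> along which they become close at a known rate
  (\<open>computable_subsequence_of_close_indices\<close>). Along \<open>r\<close> the increments of \<open>q\<close> converge
  computably to \<open>0\<close>, therefore so do those of \<open>p\<close>. Since \<open>p\<close> is monotone, each single step
  of \<open>p\<close> is bounded by the increment over the block \<open>{r m..r (m + 1)}\<close> that contains it
  (\<open>mono_increments_converge_computably\<close>).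
\<close>

section \<open>Closure properties of total recursive functions\<close>

text \<open>Search and recursion need auxiliary arguments, so unary computability is embedded into
  computability on argument lists of a fixed length.\<close>

definition list_computable :: "nat \<Rightarrow> (nat list \<Rightarrow> nat) \<Rightarrow> bool" where
  "list_computable k F \<longleftrightarrow> (\<exists>c. \<forall>xs. length xs = k \<longrightarrow> computes c xs (F xs))"

lemma list_computableE:
  assumes "list_computable k F"
  obtains c where "\<And>xs. length xs = k \<Longrightarrow> computes c xs (F xs)"
  using assms unfolding list_computable_def by blast

lemma list_computable_Nth: "i < k \<Longrightarrow> list_computable k (\<lambda>xs. xs ! i)"
  unfolding list_computable_def by (blast intro: computes_Proj)

lemma computable_iff_list_computable: "computable f \<longleftrightarrow> list_computable 1 (\<lambda>xs. f (xs ! 0))"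
  unfolding computable_def list_computable_def by (force simp: length_Suc_conv)

lemma list_computable_comp1:
  assumes "computable h" "list_computable k F"
  shows "list_computable k (\<lambda>xs. h (F xs))"
proof -
  obtain c where c: "\<And>n. computes c [n] (h n)"
    using assms(1) unfolding computable_def by blast
  obtain d where d: "\<And>xs. length xs = k \<Longrightarrow> computes d xs (F xs)"
    using assms(2) by (rule list_computableE) blast
  have "computes (Comp c [d]) xs (h (F xs))" if "length xs = k" for xs
    by (rule computes_Comp[where ys = "[F xs]"]) (simp_all add: c d that)
  then show ?thesis unfolding list_computable_def by blast
qed

lemma list_computable_comp2:
  assumes "list_computable 2 H" "list_computable k F" "list_computable k G"
  shows "list_computable k (\<lambda>xs. H [F xs, G xs])"
proof -
  obtain c where c: "\<And>xs. length xs = 2 \<Longrightarrow> computes c xs (H xs)"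
    using assms(1) by (rule list_computableE) blast
  obtain d where d: "\<And>xs. length xs = k \<Longrightarrow> computes d xs (F xs)"
    using assms(2) by (rule list_computableE) blast
  obtain e where e: "\<And>xs. length xs = k \<Longrightarrow> computes e xs (G xs)"
    using assms(3) by (rule list_computableE) blast
  have "computes (Comp c [d, e]) xs (H [F xs, G xs])" if "length xs = k" for xs
    by (rule computes_Comp[where ys = "[F xs, G xs]"]) (simp_all add: c d e that)
  then show ?thesis unfolding list_computable_def by blast
qed

lemma computable_Suc: "computable Suc"
  unfolding computable_def by (blast intro: computes_Succ)

lemmas list_computable_Suc = list_computable_comp1[OF computable_Suc]

lemma list_computable_const: "list_computable k (\<lambda>_. n)"
proof (induction n)
  case 0
  show ?case unfolding list_computable_def by (blast intro: computes_Zero)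
next
  case (Suc n)
  then show ?case by (rule list_computable_Suc)
qed

lemma list_computable_Prim:
  assumes "list_computable k F" "list_computable (Suc (Suc k)) G"
  shows "list_computable (Suc k)
    (\<lambda>xs. rec_nat (F (tl xs)) (\<lambda>n y. G (n # y # tl xs)) (hd xs))"
proof -
  obtain c where c: "\<And>xs. length xs = k \<Longrightarrow> computes c xs (F xs)"
    using assms(1) by (rule list_computableE) blast
  obtain d where d: "\<And>xs. length xs = Suc (Suc k) \<Longrightarrow> computes d xs (G xs)"
    using assms(2) by (rule list_computableE) blast
  have "computes (Prim c d) (n # xs) (rec_nat (F xs) (\<lambda>n y. G (n # y # xs)) n)"
    if "length xs = k" for n xs
  proof (induction n)
    case 0
    show ?case using c[OF that] by (simp add: computes_Prim_0)
  next
    case (Suc n)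
    then show ?case
      using d[of "n # rec_nat (F xs) (\<lambda>n y. G (n # y # xs)) n # xs"] that
      by (simp add: computes_Prim_Suc)
  qed
  then show ?thesis unfolding list_computable_def
    by (intro exI[of _ "Prim c d"]) (auto simp: length_Suc_conv)
qed

lemma list_computable_Least:
  assumes "list_computable (Suc k) F"
    and ex: "\<And>xs. length xs = k \<Longrightarrow> \<exists>n. F (n # xs) = 0"
  shows "list_computable k (\<lambda>xs. LEAST n. F (n # xs) = 0)"
proof -
  obtain c where c: "\<And>xs. length xs = Suc k \<Longrightarrow> computes c xs (F xs)"
    using assms(1) by (rule list_computableE) blast
  have "computes (Mu c) xs (LEAST n. F (n # xs) = 0)" if len: "length xs = k" for xs
  proof (rule computes_Mu)
    have "F ((LEAST n. F (n # xs) = 0) # xs) = 0"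
      using ex[OF len] by (rule LeastI_ex)
    then show "computes c ((LEAST n. F (n # xs) = 0) # xs) 0"
      using c[of "(LEAST n. F (n # xs) = 0) # xs"] len by simp
    show "\<forall>i < (LEAST n. F (n # xs) = 0). \<exists>y. computes c (i # xs) (Suc y)"
    proof (intro allI impI)
      fix i assume "i < (LEAST n. F (n # xs) = 0)"
      then have "F (i # xs) \<noteq> 0" by (rule not_less_Least)
      then show "\<exists>y. computes c (i # xs) (Suc y)"
        using c[of "i # xs"] len by (metis length_Cons not0_implies_Suc)
    qed
  qed
  then show ?thesis unfolding list_computable_def by blast
qed

lemma computable_rec:
  assumes "list_computable 2 G"
  shows "computable (rec_nat b (\<lambda>n y. G [n, y]))"
proof -
  have "list_computable 1 (\<lambda>xs. rec_nat b (\<lambda>n y. G (n # y # tl xs)) (hd xs))"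
    using list_computable_Prim[OF list_computable_const[of 0 b], of G] assms
    by (simp add: numeral_2_eq_2)
  then show ?thesis
    unfolding computable_def list_computable_def by (force simp: length_Suc_conv)
qed

lemma computable_pred: "computable (\<lambda>n. n - 1)"
proof -
  have "computable (rec_nat 0 (\<lambda>n y. [n, y] ! 0))"
    by (rule computable_rec[of "\<lambda>xs. xs ! 0"]) (simp add: list_computable_Nth)
  moreover have "rec_nat 0 (\<lambda>n y. [n, y] ! 0) = (\<lambda>n. n - 1)"
  proof
    fix n :: nat
    show "rec_nat 0 (\<lambda>n y. [n, y] ! 0) n = n - 1"
      by (cases n) auto
  qed
  ultimately show ?thesis by (simp only:)
qed

lemma list_computable_binary_rec:
  assumes "list_computable 1 F" "list_computable 3 G"
    and "\<And>y. H [0, y] = F [y]"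
    and "\<And>n y. H [Suc n, y] = G [n, H [n, y], y]"
  shows "list_computable 2 H"
proof -
  define R where "R xs = rec_nat (F (tl xs)) (\<lambda>n y. G (n # y # tl xs)) (hd xs)" for xs
  have "R [n, y] = H [n, y]" for n y
    by (induction n) (simp_all add: R_def assms(3,4))
  then have "R xs = H xs" if "length xs = 2" for xs
    using that by (auto simp: length_Suc_conv numeral_2_eq_2)
  moreover have "list_computable 2 R"
    unfolding R_def using list_computable_Prim[of 1 F G] assms(1,2)
    by (simp add: numeral_2_eq_2 numeral_3_eq_3)
  ultimately show ?thesis
    unfolding list_computable_def by metis
qed

lemma list_computable_add:
  assumes "list_computable k F" "list_computable k G"
  shows "list_computable k (\<lambda>xs. F xs + G xs)"
proof -
  have "list_computable 2 (\<lambda>xs. xs ! 0 + xs ! 1)"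
    by (rule list_computable_binary_rec[of "\<lambda>xs. xs ! 0" "\<lambda>xs. Suc (xs ! 1)"])
       (simp_all add: list_computable_Nth list_computable_Suc)
  from list_computable_comp2[OF this assms] show ?thesis by simp
qed

lemma list_computable_mult:
  assumes "list_computable k F" "list_computable k G"
  shows "list_computable k (\<lambda>xs. F xs * G xs)"
proof -
  have "list_computable 2 (\<lambda>xs. xs ! 0 * xs ! 1)"
    by (rule list_computable_binary_rec[of "\<lambda>_. 0" "\<lambda>xs. xs ! 2 + xs ! 1"])
       (simp_all add: list_computable_Nth list_computable_const list_computable_add)
  from list_computable_comp2[OF this assms] show ?thesis by simp
qed

lemma list_computable_diff:
  assumes "list_computable k F" "list_computable k G"
  shows "list_computable k (\<lambda>xs. F xs - G xs)"
proof -
  have "list_computable 2 (\<lambda>xs. xs ! 1 - xs ! 0)"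
    by (rule list_computable_binary_rec[of "\<lambda>xs. xs ! 0" "\<lambda>xs. xs ! 1 - 1"])
       (simp_all add: list_computable_Nth list_computable_comp1[OF computable_pred]
         del: One_nat_def)
  from list_computable_comp2[OF this assms(2,1)] show ?thesis by simp
qed

lemma list_computable_power_2:
  assumes "list_computable k F"
  shows "list_computable k (\<lambda>xs. 2 ^ F xs)"
proof -
  have "list_computable 2 (\<lambda>xs. 2 * xs ! 1)"
    by (intro list_computable_mult list_computable_const list_computable_Nth) simp
  then have "computable (rec_nat 1 (\<lambda>n y. 2 * [n, y] ! 1))"
    by (rule computable_rec)
  moreover have "rec_nat 1 (\<lambda>n y. 2 * [n, y] ! 1) = (\<lambda>n. 2 ^ n)"
  proof
    fix n :: nat
    show "rec_nat 1 (\<lambda>n y. 2 * [n, y] ! 1) n = 2 ^ n"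
      by (induction n) auto
  qed
  ultimately have "computable (\<lambda>n. 2 ^ n)" by (simp only:)
  from list_computable_comp1[OF this assms] show ?thesis .
qed

lemmas list_computable_intros =
  list_computable_Nth list_computable_const list_computable_Suc list_computable_add
  list_computable_mult list_computable_diff list_computable_power_2

lemma computable_comp: "computable f \<Longrightarrow> computable g \<Longrightarrow> computable (\<lambda>n. f (g n))"
  using computable_iff_list_computable list_computable_comp1 by auto

lemma computable_add: "computable f \<Longrightarrow> computable g \<Longrightarrow> computable (\<lambda>n. f n + g n)"
  unfolding computable_iff_list_computable by (rule list_computable_add)

section \<open>Comparing computable rational sequences\<close>

text \<open>Clearing denominators turns the inequality into one between natural numbers, which
  truncated subtraction expresses as the vanishing of a number.\<close>

lemma rat_close_decidable:
  assumes "computable_rat_seq p" "computable_rat_seq q"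
  obtains T where "list_computable 2 T"
    and "\<And>i n. T [i, n] = 0 \<longleftrightarrow> \<bar>p i - q i\<bar> \<le> (1 / 2) ^ n"
proof -
  obtain a b c where comp: "computable a" "computable b" "computable c"
    and p: "\<And>n. p n = (of_nat (a n) - of_nat (b n)) / of_nat (Suc (c n))"
    using assms(1) unfolding computable_rat_seq_def by blast
  obtain a' b' c' where comp': "computable a'" "computable b'" "computable c'"
    and q: "\<And>n. q n = (of_nat (a' n) - of_nat (b' n)) / of_nat (Suc (c' n))"
    using assms(2) unfolding computable_rat_seq_def by blast
  define L where "L i n = 2 ^ n * (a i * Suc (c' i) + b' i * Suc (c i))" for i n
  define R where "R i n = 2 ^ n * (b i * Suc (c' i) + a' i * Suc (c i))" for i n
  define E where "E i = Suc (c i) * Suc (c' i)" for i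
  define T where "T xs = (L (xs ! 0) (xs ! 1) - (R (xs ! 0) (xs ! 1) + E (xs ! 0)))
    + (R (xs ! 0) (xs ! 1) - (L (xs ! 0) (xs ! 1) + E (xs ! 0)))" for xs
  have "list_computable 2 T"
    unfolding T_def L_def R_def E_def
    by (intro list_computable_intros comp[THEN list_computable_comp1]
        comp'[THEN list_computable_comp1]) simp_all
  moreover have "T [i, n] = 0 \<longleftrightarrow> \<bar>p i - q i\<bar> \<le> (1 / 2) ^ n" for i n
  proof -
    define l r e where "l = (of_nat (L i n) :: rat)" "r = (of_nat (R i n) :: rat)"
      "e = (of_nat (E i) :: rat)"
    have e: "e > 0" by (simp add: l_r_e_def E_def del: of_nat_mult)
    have "l - r = 2 ^ n * e * (p i - q i)"
      unfolding l_r_e_def L_def R_def E_def p q of_nat_mult of_nat_add of_nat_power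
      by (simp add: divide_simps del: of_nat_Suc) (simp add: algebra_simps)
    then have diff: "\<bar>l - r\<bar> = 2 ^ n * e * \<bar>p i - q i\<bar>"
      using e by (simp add: abs_mult)
    have "T [i, n] = 0 \<longleftrightarrow> L i n \<le> R i n + E i \<and> R i n \<le> L i n + E i"
      by (simp add: T_def)
    also have "\<dots> \<longleftrightarrow> l \<le> r + e \<and> r \<le> l + e"
      unfolding l_r_e_def of_nat_add[symmetric] of_nat_le_iff ..
    also have "\<dots> \<longleftrightarrow> \<bar>l - r\<bar> \<le> e" by linarith
    also have "\<dots> \<longleftrightarrow> \<bar>p i - q i\<bar> \<le> (1 / 2) ^ n"
      unfolding diff using e by (simp add: power_one_over field_simps)
    finally show ?thesis .
  qed
  ultimately show ?thesis by (rule that)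
qed

text \<open>The search always succeeds because the distance of the two sequences tends to \<open>0\<close>.
  The start \<open>r 0\<close> is arbitrary, hence the shift by one in the estimate.\<close>

lemma computable_subsequence_of_close_indices:
  assumes "computable_rat_seq p" "computable_rat_seq q"
    and "(\<lambda>n. real_of_rat (p n)) \<longlonglongrightarrow> x" "(\<lambda>n. real_of_rat (q n)) \<longlonglongrightarrow> x"
  obtains r where "computable r" "strict_mono r"
    and "\<And>n. \<bar>real_of_rat (p (r (Suc n))) - real_of_rat (q (r (Suc n)))\<bar> \<le> (1 / 2) ^ n"
proof -
  have of_rat_close: "\<bar>p i - q i\<bar> \<le> (1 / 2) ^ n \<longleftrightarrow>
      \<bar>real_of_rat (p i) - real_of_rat (q i)\<bar> \<le> (1 / 2) ^ n" for i n
  proof -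
    have "\<bar>p i - q i\<bar> \<le> (1 / 2) ^ n \<longleftrightarrow>
        p i \<le> q i + (1 / 2) ^ n \<and> q i \<le> p i + (1 / 2) ^ n"
      by linarith
    also have "\<dots> \<longleftrightarrow> real_of_rat (p i) \<le> real_of_rat (q i + (1 / 2) ^ n) \<and>
        real_of_rat (q i) \<le> real_of_rat (p i + (1 / 2) ^ n)"
      by (simp only: of_rat_less_eq)
    also have "\<dots> \<longleftrightarrow> \<bar>real_of_rat (p i) - real_of_rat (q i)\<bar> \<le> (1 / 2) ^ n"
      by (simp only: of_rat_add of_rat_power of_rat_divide of_rat_1 of_rat_numeral_eq) linarith
    finally show ?thesis .
  qed
  obtain T where T: "list_computable 2 T"
    and T0: "\<And>i n. T [i, n] = 0 \<longleftrightarrow> \<bar>p i - q i\<bar> \<le> (1 / 2) ^ n"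
    by (rule rat_close_decidable[OF assms(1,2)]) (rule that)
  define F where "F xs = (Suc (xs ! 2) - xs ! 0) + T [xs ! 0, xs ! 1]" for xs
  have F0: "F [i, n, y] = 0 \<longleftrightarrow> y < i \<and> \<bar>p i - q i\<bar> \<le> (1 / 2) ^ n" for i n y
    by (auto simp: F_def T0)
  have "list_computable 3 F"
    unfolding F_def by (intro list_computable_intros list_computable_comp2[OF T]) simp_all
  have ex: "\<exists>i. F [i, n, y] = 0" for n y
  proof -
    have "(\<lambda>i. real_of_rat (p i) - real_of_rat (q i)) \<longlonglongrightarrow> 0"
      using tendsto_diff[OF assms(3,4)] by simp
    then have "\<forall>\<^sub>F i in sequentially.
        \<bar>real_of_rat (p i) - real_of_rat (q i)\<bar> < (1 / 2) ^ n"
      by (auto simp: tendsto_iff dist_real_def dest: spec[of _ "(1 / 2) ^ n"])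
    moreover have "\<forall>\<^sub>F i in sequentially. y < i" by (rule eventually_gt_at_top)
    ultimately have "\<forall>\<^sub>F i in sequentially. F [i, n, y] = 0"
      by eventually_elim (simp add: F0 of_rat_close)
    then show ?thesis by (rule eventually_happens'[OF sequentially_bot])
  qed
  define G where "G xs = (LEAST i. F (i # xs) = 0)" for xs
  have G: "F [G [n, y], n, y] = 0" for n y
    unfolding G_def using ex by (rule LeastI_ex)
  have "list_computable 2 G"
    unfolding G_def using \<open>list_computable 3 F\<close> ex
    by (intro list_computable_Least) (auto simp: length_Suc_conv numeral_2_eq_2 numeral_3_eq_3)
  define r where "r = rec_nat 0 (\<lambda>n y. G [n, y])"
  have r: "F [r (Suc n), n, r n] = 0" for n
    using G by (simp add: r_def)
  show ?thesis
  proof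
    show "computable r"
      unfolding r_def using \<open>list_computable 2 G\<close> by (rule computable_rec)
    show "strict_mono r"
      using r by (simp add: strict_mono_Suc_iff F0)
    show "\<bar>real_of_rat (p (r (Suc n))) - real_of_rat (q (r (Suc n)))\<bar> \<le> (1 / 2) ^ n" for n
      using r[of n] by (simp add: F0 of_rat_close)
  qed
qed

lemma strict_mono_block:
  fixes r :: "nat \<Rightarrow> nat"
  assumes "strict_mono r" "r m \<le> k"
  obtains j where "m \<le> j" "r j \<le> k" "k < r (Suc j)"
proof -
  have ex: "k < r (Suc k)"
    using strict_mono_imp_increasing[OF assms(1), of "Suc k"] by simp
  define i where "i = (LEAST i. k < r i)"
  have i: "k < r i" unfolding i_def by (rule LeastI[of "\<lambda>i. k < r i", OF ex])
  then have "m < i" using assms by (metis le_less_trans strict_mono_less)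
  then obtain j where j: "i = Suc j" "m \<le> j" by (cases i) auto
  have "r j \<le> k"
    using not_less_Least[of j "\<lambda>i. k < r i"] j(1) unfolding i_def by simp
  then show ?thesis using that j i by blast
qed

text \<open>Choose \<open>r\<close> so that \<open>p\<close> and the nearly computably convergent sequence are close along it.
  By monotonicity, a step of \<open>p\<close> inside a block \<open>{r j..r (j + 1)}\<close> is at most the increment of
  \<open>p\<close> over the whole block, and that increment is close to the one of the other sequence.\<close>

lemma mono_increments_converge_computably:
  assumes "nearly_computable x" "computable_rat_seq p"
    and lim: "(\<lambda>n. real_of_rat (p n)) \<longlonglongrightarrow> x" and mono: "mono p"
  shows "converges_computably (\<lambda>n. real_of_rat (p (Suc n)) - real_of_rat (p n)) 0"
proof -
  obtain q where q: "computable_rat_seq q" "(\<lambda>n. real_of_rat (q n)) \<longlonglongrightarrow> x"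
    and near: "nearly_computably_convergent (\<lambda>n. real_of_rat (q n))"
    using assms(1) unfolding nearly_computable_def by blast
  obtain r where r: "computable r" "strict_mono r"
    and close: "\<And>n. \<bar>real_of_rat (p (r (Suc n))) - real_of_rat (q (r (Suc n)))\<bar> \<le> (1 / 2) ^ n"
    using assms(2) q(1) lim q(2) by (rule computable_subsequence_of_close_indices) blast
  have "converges_computably (\<lambda>n. real_of_rat (q (r (n + 1))) - real_of_rat (q (r n))) 0"
    using near r unfolding nearly_computably_convergent_def by blast
  then obtain s where s: "computable s"
    and small: "\<And>n k. s n \<le> k \<Longrightarrow>
      \<bar>real_of_rat (q (r (Suc k))) - real_of_rat (q (r k))\<bar> \<le> (1 / 2) ^ n"
    unfolding converges_computably_def by (auto simp: abs_minus_commute)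
  \<comment> \<open>Three errors share the target \<open>(1 / 2) ^ n\<close>: an increment of \<open>q\<close> takes a quarter, and the
    distances between \<open>p\<close> and \<open>q\<close> at the two ends of the block take a half and a quarter.\<close>
  define M where "M n = r (s (n + 2) + (n + 2))" for n
  have "computable M"
  proof -
    have "computable (\<lambda>n. n + 2)"
      unfolding computable_iff_list_computable by (intro list_computable_intros) simp
    then show ?thesis
      unfolding M_def
      by (rule computable_comp[OF r(1) computable_add[OF computable_comp[OF s]]]) fact
  qed
  moreover have bound: "\<bar>0 - (real_of_rat (p (Suc k)) - real_of_rat (p k))\<bar> \<le> (1 / 2) ^ n"
    if k: "M n \<le> k" for n k
  proof -
    obtain j where j: "s (n + 2) + (n + 2) \<le> j" "r j \<le> k" "k < r (Suc j)"
      by (rule strict_mono_block[OF r(2) k[unfolded M_def]])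
    then obtain i where i: "j = Suc i" "n + 1 \<le> i" by (cases j) auto
    have "real_of_rat (p (r j)) \<le> real_of_rat (p k)"
      "real_of_rat (p k) \<le> real_of_rat (p (Suc k))"
      "real_of_rat (p (Suc k)) \<le> real_of_rat (p (r (Suc j)))"
      using j by (simp_all add: of_rat_less_eq monoD[OF mono])
    moreover have "\<bar>real_of_rat (q (r (Suc j))) - real_of_rat (q (r j))\<bar> \<le> (1 / 2) ^ (n + 2)"
      using j(1) by (intro small) linarith
    moreover have "\<bar>real_of_rat (p (r (Suc j))) - real_of_rat (q (r (Suc j)))\<bar> \<le> (1 / 2) ^ j"
      by (rule close)
    moreover have "\<bar>real_of_rat (p (r j)) - real_of_rat (q (r j))\<bar> \<le> (1 / 2) ^ i"
      using close i by simp
    moreover have "(1 / 2 :: real) ^ j \<le> (1 / 2) ^ (n + 2)" "(1 / 2 :: real) ^ i \<le> (1 / 2) ^ (n + 1)"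
      using j i by (simp_all only: power_decreasing_iff)
    moreover have "(1 / 2 :: real) ^ (n + 2) = (1 / 2) ^ n / 4"
      "(1 / 2 :: real) ^ (n + 1) = (1 / 2) ^ n / 2"
      by simp_all
    ultimately show ?thesis by linarith
  qed
  moreover have "(\<lambda>n. real_of_rat (p (Suc n)) - real_of_rat (p n)) \<longlonglongrightarrow> 0"
    using tendsto_diff[OF lim[THEN LIMSEQ_Suc] lim] by simp
  ultimately show ?thesis unfolding converges_computably_def by blast
qed

section \<open>Names and the reordered series\<close>

lemma partial_sums_computable_rat_seq:
  assumes f: "computable f"
  shows "computable_rat_seq (\<lambda>n. \<Sum>k<n. (1 / 2) ^ f k)"
proof -
  \<comment> \<open>\<open>D n\<close> is a common denominator of the first \<open>n\<close> terms and \<open>N n\<close> the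
    numerator of their sum.\<close>
  define D where "D = rec_nat (1 :: nat) (\<lambda>n y. y * 2 ^ f n)"
  define N where "N = rec_nat 0 (\<lambda>n y. y * 2 ^ f n + D n)"
  have D: "computable D"
    unfolding D_def using computable_rec[of "\<lambda>xs. xs ! 1 * 2 ^ f (xs ! 0)" 1]
    by (simp add: list_computable_intros list_computable_comp1[OF f])
  have N: "computable N"
    unfolding N_def using computable_rec[of "\<lambda>xs. xs ! 1 * 2 ^ f (xs ! 0) + D (xs ! 0)" 0]
    by (simp add: list_computable_intros list_computable_comp1[OF f] list_computable_comp1[OF D])
  have Dpos: "D n > 0" for n
    by (induction n) (simp_all add: D_def)
  have "(\<Sum>k<n. (1 / 2 :: rat) ^ f k) = of_nat (N n) / of_nat (D n)" for n
  proof (induction n)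
    case 0
    show ?case by (simp add: N_def)
  next
    case (Suc n)
    have "D (Suc n) = D n * 2 ^ f n" "N (Suc n) = N n * 2 ^ f n + D n"
      by (simp_all add: D_def N_def)
    then show ?case using Suc Dpos[of n] by (simp add: field_simps power_one_over)
  qed
  moreover have "computable (\<lambda>_. 0)"
    unfolding computable_iff_list_computable by (rule list_computable_const)
  moreover have "computable (\<lambda>n. D n - 1)"
    by (rule computable_comp[OF computable_pred D])
  ultimately show ?thesis
    unfolding computable_rat_seq_def using N Dpos
    by (intro exI[of _ N] exI[of _ "\<lambda>_. 0"] exI[of _ "\<lambda>n. D n - 1"]) simp
qed

text \<open>Grouping the terms of a segment by their exponent \<open>j\<close> yields at most \<open>u f j\<close> terms in
  each group.\<close>

lemma name_segment_le_reordered_tail: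
  fixes f :: "nat \<Rightarrow> nat"
  assumes fin: "\<And>j. finite {k. f k = j}" and "finite A"
    and range: "\<And>k. k \<in> A \<Longrightarrow> G \<le> f k \<and> f k < J"
  shows "(\<Sum>k\<in>A. (1 / 2 :: real) ^ f k) \<le> (\<Sum>j = G..<J. of_nat (u f j) * (1 / 2) ^ j)"
proof -
  have "(\<Sum>k\<in>A. (1 / 2 :: real) ^ f k)
      = (\<Sum>j = G..<J. \<Sum>k\<in>{k \<in> A. f k = j}. (1 / 2) ^ f k)"
    using \<open>finite A\<close> range by (intro sum.group[symmetric]) auto
  also have "\<dots> = (\<Sum>j = G..<J. of_nat (card {k \<in> A. f k = j}) * (1 / 2) ^ j)"
    by (intro sum.cong) simp_all
  also have "\<dots> \<le> (\<Sum>j = G..<J. of_nat (u f j) * (1 / 2) ^ j)"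
    unfolding u_def by (intro sum_mono mult_right_mono of_nat_mono card_mono fin) auto
  finally show ?thesis .
qed

text \<open>Beyond a suitable index \<open>f\<close> takes only values in a small tail of the reordered series. The
  modulus of convergence of the terms makes that index computable: a term is at most
  \<open>(1 / 2) ^ n\<close> exactly if \<open>f\<close> is at least \<open>n\<close> there.\<close>

lemma name_series_converges_computably:
  assumes name: "is_name f x"
    and reordered: "series_converges_computably (\<lambda>k. of_nat (u f k) * (1 / 2) ^ k)"
    and terms: "converges_computably (\<lambda>k. (1 / 2) ^ f k) 0"
  shows "converges_computably (\<lambda>n. \<Sum>k<n. (1 / 2) ^ f k) x"
proof -
  have lim: "(\<lambda>n. \<Sum>k<n. (1 / 2) ^ f k) \<longlonglongrightarrow> x"
    using name unfolding is_name_def sums_def .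
  define S where "S n = (\<Sum>j<n. of_nat (u f j) * (1 / 2 :: real) ^ j)" for n
  obtain y g where S: "S \<longlonglongrightarrow> y" and g: "computable g"
    and tail: "\<And>n k. g n \<le> k \<Longrightarrow> \<bar>y - S k\<bar> \<le> (1 / 2) ^ n"
    using reordered unfolding series_converges_computably_def converges_computably_def S_def
    by blast
  obtain m where m: "computable m" and "\<And>n k. m n \<le> k \<Longrightarrow> (1 / 2 :: real) ^ f k \<le> (1 / 2) ^ n"
    using terms unfolding converges_computably_def by auto
  then have f: "n \<le> f k" if "m n \<le> k" for n k
    using that by (simp add: power_decreasing_iff)
  have S_le: "S J \<le> y" for J
    by (rule incseq_le[OF _ S]) (auto simp: incseq_def S_def intro!: sum_mono2)
  have bound: "\<bar>x - (\<Sum>k<i. (1 / 2) ^ f k)\<bar> \<le> (1 / 2) ^ n" if i: "m (g n) \<le> i" for n i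
  proof -
    have "(\<Sum>k<l. (1 / 2) ^ f k) \<le> (\<Sum>k<i. (1 / 2) ^ f k) + (1 / 2 :: real) ^ n"
      if "i \<le> l" for l
    proof -
      define J where "J = g n + Suc (\<Sum>k<l. f k)"
      have "f k < J" if "k < l" for k
        using member_le_sum[of k "{..<l}" f] that by (simp add: J_def)
      then have "(\<Sum>k = i..<l. (1 / 2 :: real) ^ f k)
          \<le> (\<Sum>j = g n..<J. of_nat (u f j) * (1 / 2) ^ j)"
        using i by (intro name_segment_le_reordered_tail is_name_finite_fiber[OF name])
          (auto intro: f)
      also have "\<dots> = S J - S (g n)"
        unfolding S_def J_def lessThan_atLeast0 by (subst sum_diff_nat_ivl) simp_all
      also have "\<dots> \<le> (1 / 2) ^ n"
        using tail[of n "g n"] S_le[of J] by simp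
      finally have "(\<Sum>k = i..<l. (1 / 2 :: real) ^ f k) \<le> (1 / 2) ^ n" .
      moreover have "(\<Sum>k<l. (1 / 2 :: real) ^ f k)
          = (\<Sum>k<i. (1 / 2) ^ f k) + (\<Sum>k = i..<l. (1 / 2) ^ f k)"
        using that by (simp add: lessThan_atLeast0 sum.atLeastLessThan_concat)
      ultimately show ?thesis by linarith
    qed
    then have "x \<le> (\<Sum>k<i. (1 / 2) ^ f k) + (1 / 2) ^ n"
      by (intro LIMSEQ_le_const2[OF lim]) blast
    moreover have "(\<Sum>k<i. (1 / 2) ^ f k) \<le> x"
      by (rule incseq_le[OF _ lim]) (auto simp: incseq_def intro!: sum_mono2)
    ultimately show ?thesis by linarith
  qed
  show ?thesis
    unfolding converges_computably_def
    using lim bound computable_comp[OF m g] by blast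
qed

theorem theorem23:
  fixes x :: real
  assumes "reordered_computable x" and "nearly_computable x"
  shows "computable_real x"
proof -
  obtain f where f: "computable f" and name: "is_name f x"
    and reordered: "series_converges_computably (\<lambda>k. of_nat (u f k) * (1 / 2) ^ k)"
    using assms(1) unfolding reordered_computable_def by blast
  define p where "p n = (\<Sum>k<n. (1 / 2 :: rat) ^ f k)" for n
  have p: "computable_rat_seq p"
    unfolding p_def by (rule partial_sums_computable_rat_seq[OF f])
  have real_p: "real_of_rat (p n) = (\<Sum>k<n. (1 / 2) ^ f k)" for n
    by (simp add: p_def of_rat_sum of_rat_power of_rat_divide)
  have lim: "(\<lambda>n. real_of_rat (p n)) \<longlonglongrightarrow> x"
    using name unfolding is_name_def sums_def real_p .
  have "mono p"
    unfolding p_def by (auto simp: mono_def intro!: sum_mono2)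
  from mono_increments_converge_computably[OF assms(2) p lim this]
  have "converges_computably (\<lambda>k. (1 / 2) ^ f k) 0"
    by (simp add: real_p)
  then have "converges_computably (\<lambda>n. real_of_rat (p n)) x"
    unfolding real_p by (rule name_series_converges_computably[OF name reordered])
  then show ?thesis
    unfolding computable_real_def using p by blast
qed

end
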